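(* Let $a\ge 3$ be an integer, $p\in(0,1)$, $q=1-p$, and let $u(z;\gamma)$ be the $\gamma$-discounted ruin probability of the biased random walk on $\{0,1,\dots,a\}$ defined in the context. For any two distinct reset sites $z\neq z'$ in $\{1,\dots,a-1\}$, the ratio $R(\gamma)=u(z;\gamma)/u(z';\gamma)$ is strictly monotone on $(0,1)$.
   Context: Let $(X_n)_{n\ge0}$ be the random walk (without resetting) on $\{0,1,\dots,a\}$ with absorbing boundaries $0$ and $a$, which from each $x\in\{1,\dots,a-1\}$ moves to $x+1$ with probability $p$ and to $x-1$ with probability $q$. Let $\tau_0,\tau_a$ be the hitting times of $0$ and $a$. For $z\in\{1,\dots,a-1\}$ and $\gamma\in(0,1)$, $$u(z;\gamma)=\mathbb{E}_z\bigl[(1-\gamma)^{\tau_0}\mathbf{1}_{\{\tau_0<\tau_a\}}\bigr].$$ *)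

theory Defs
  imports "HOL-Probability.Probability"
begin

definition ruin_kernel :: "real \<Rightarrow> nat \<Rightarrow> nat \<Rightarrow> nat \<Rightarrow> real" where
  "ruin_kernel p a x y =
     (if x = 0 \<or> x = a then (if y = x then 1 else 0)
      else if y = x + 1 then p
      else if y = x - 1 then 1 - p
      else 0)"

text \<open>
  Elementary Markov property: after multiplication by the probability of the past, so that
  pasts of probability zero need no separate treatment.
\<close>

locale ruin_walk = prob_space M for M :: "'w measure" +
  fixes X :: "nat \<Rightarrow> 'w \<Rightarrow> nat" and p :: real and a z :: nat
  assumes measurable_walk: "\<And>n. X n \<in> measurable M (count_space {0..a})"
    and start: "prob {\<omega> \<in> space M. X 0 \<omega> = z} = 1"
    and markov: "\<And>n x y.
      prob {\<omega> \<in> space M. (\<forall>i\<le>n. X i \<omega> = x i) \<and> X (Suc n) \<omega> = y} =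
      prob {\<omega> \<in> space M. \<forall>i\<le>n. X i \<omega> = x i} * ruin_kernel p a (x n) y"

text \<open>The infimum of the empty set is \<open>\<infinity>\<close>, so the value is \<open>\<infinity>\<close> if \<open>b\<close> is never reached.\<close>

definition hitting_time :: "(nat \<Rightarrow> 'w \<Rightarrow> nat) \<Rightarrow> nat \<Rightarrow> 'w \<Rightarrow> enat" where
  "hitting_time X b \<omega> = (INF n \<in> {n. X n \<omega> = b}. enat n)"

text \<open>On \<open>\<tau>\<^sub>0 < \<tau>\<^sub>a\<close> the time \<open>\<tau>\<^sub>0\<close> is finite, so \<open>the_enat\<close> is only used on finite values.\<close>

definition discounted_ruin :: "'w measure \<Rightarrow> (nat \<Rightarrow> 'w \<Rightarrow> nat) \<Rightarrow> nat \<Rightarrow> real \<Rightarrow> real" where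
  "discounted_ruin M X a \<gamma> =
     (\<integral>\<omega>. (1 - \<gamma>) ^ the_enat (hitting_time X 0 \<omega>)
           * indicator {\<omega>. hitting_time X 0 \<omega> < hitting_time X a \<omega>} \<omega> \<partial>M)"

text \<open>Such walks exist: drive the recursion by a stream of independent coin flips.\<close>

primrec coin_walk :: "nat \<Rightarrow> nat \<Rightarrow> nat \<Rightarrow> bool stream \<Rightarrow> nat" where
  "coin_walk a z 0 \<omega> = z"
| "coin_walk a z (Suc n) \<omega> =
     coin_walk a (if z = 0 \<or> z = a then z else if shd \<omega> then z + 1 else z - 1) n (stl \<omega>)"

lemma coin_walk_le: "z \<le> a \<Longrightarrow> coin_walk a z n \<omega> \<le> a"
  by (induction n arbitrary: z \<omega>) auto

lemma measurable_coin_walk [measurable]: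
  "coin_walk a z n \<in> measurable (stream_space (measure_pmf r)) (count_space UNIV)"
proof (induction n arbitrary: z)
  case 0
  have "coin_walk a z 0 = (\<lambda>_. z)" by auto
  then show ?case by simp
next
  case (Suc n)
  note Suc.IH [measurable]
  have "coin_walk a z (Suc n) =
    (\<lambda>\<omega>. if z = 0 \<or> z = a then coin_walk a z n (stl \<omega>)
       else if shd \<omega> then coin_walk a (z + 1) n (stl \<omega>) else coin_walk a (z - 1) n (stl \<omega>))"
    by auto
  moreover have "\<dots> \<in> measurable (stream_space (measure_pmf r)) (count_space UNIV)"
    by measurable
  ultimately show ?case by simp
qed

lemma ruin_walk_coin_walk:
  assumes "0 \<le> p" "p \<le> 1" "z \<le> a"
  shows "ruin_walk (stream_space (measure_pmf (bernoulli_pmf p))) (coin_walk a z) p a z"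
proof -
  define B where "B = measure_pmf (bernoulli_pmf p)"
  interpret B: prob_space B unfolding B_def by (rule measure_pmf.prob_space_axioms)
  interpret S: prob_space "stream_space B" by (rule B.prob_space_stream_space)
  have meas [measurable]: "coin_walk a z n \<in> measurable (stream_space B) (count_space UNIV)" for z n
    unfolding B_def by measurable
  have sp: "space (stream_space B) = UNIV" by (simp add: space_stream_space B_def)
  have first: "S.prob {\<omega>. P (shd \<omega>) (stl \<omega>)} =
      p * S.prob {\<omega>. P True \<omega>} + (1 - p) * S.prob {\<omega>. P False \<omega>}"
    if [measurable]: "\<And>b. {\<omega>. P b \<omega>} \<in> sets (stream_space B)" for P
  proof -
    have set: "{\<omega>. P (shd \<omega>) (stl \<omega>)} \<in> sets (stream_space B)"
    proof -
      have "shd -` {b} \<inter> space (stream_space B) \<in> sets (stream_space B)" for b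
        by (rule measurable_sets[OF measurable_shd]) (simp add: B_def)
      moreover have "stl -` {\<omega>. P b \<omega>} \<inter> space (stream_space B) \<in> sets (stream_space B)" for b
        by (rule measurable_sets[OF measurable_stl that])
      ultimately have "(shd -` {True} \<inter> stl -` {\<omega>. P True \<omega>}) \<union> (shd -` {False} \<inter> stl -` {\<omega>. P False \<omega>})
          \<in> sets (stream_space B)"
        by (simp add: sp sets.Int sets.Un)
      also have "(shd -` {True} \<inter> stl -` {\<omega>. P True \<omega>}) \<union> (shd -` {False} \<inter> stl -` {\<omega>. P False \<omega>})
          = {\<omega>. P (shd \<omega>) (stl \<omega>)}"
        by (auto simp: set_eq_iff) (metis (full_types))+
      finally show ?thesis .
    qed
    have "emeasure (stream_space B) {\<omega>. P (shd \<omega>) (stl \<omega>)} =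
       (\<integral>\<^sup>+b. emeasure (stream_space B) {\<omega>. P b \<omega>} \<partial>B)"
      by (subst B.emeasure_stream_space[OF set]) (simp add: sp)
    also have "\<dots> = ennreal p * emeasure (stream_space B) {\<omega>. P True \<omega>}
        + ennreal (1 - p) * emeasure (stream_space B) {\<omega>. P False \<omega>}"
      unfolding B_def using assms by (simp add: mult.commute)
    also have "\<dots> = ennreal (p * S.prob {\<omega>. P True \<omega>} + (1 - p) * S.prob {\<omega>. P False \<omega>})"
      using assms by (simp add: S.emeasure_eq_measure ennreal_mult ennreal_plus)
    finally show ?thesis
      using assms by (subst (asm) S.emeasure_eq_measure, subst (asm) ennreal_inj) auto
  qed
  have all_Suc: "(\<forall>i\<le>Suc n. Q i) \<longleftrightarrow> Q 0 \<and> (\<forall>i\<le>n. Q (Suc i))" for Q :: "nat \<Rightarrow> bool" and n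
    by (metis Suc_le_mono le0 not0_implies_Suc)
  have mk: "S.prob {\<omega>. (\<forall>i\<le>n. coin_walk a z i \<omega> = x i) \<and> coin_walk a z (Suc n) \<omega> = y} =
      S.prob {\<omega>. \<forall>i\<le>n. coin_walk a z i \<omega> = x i} * ruin_kernel p a (x n) y" for z n x y
  proof (induction n arbitrary: z x)
    case 0
    define w where "w b = (if z = 0 \<or> z = a then z else if b then z + 1 else z - 1)" for b
    have "S.prob {\<omega>. (\<lambda>b _. z = x 0 \<and> w b = y) (shd \<omega>) (stl \<omega>)} =
      p * S.prob {\<omega>. z = x 0 \<and> w True = y} + (1 - p) * S.prob {\<omega>. z = x 0 \<and> w False = y}"
      by (rule first) (metis (full_types) Collect_const sets.empty_sets sets.top sp)
    moreover have "S.prob UNIV = 1" using S.prob_space sp by simp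
    ultimately show ?case
      by (auto simp: w_def ruin_kernel_def)
  next
    case (Suc n)
    define w where "w b = (if z = 0 \<or> z = a then z else if b then z + 1 else z - 1)" for b
    let ?P = "\<lambda>b \<omega>. z = x 0 \<and> (\<forall>i\<le>n. coin_walk a (w b) i \<omega> = x (Suc i))"
    let ?Q = "\<lambda>b \<omega>. z = x 0 \<and> (\<forall>i\<le>n. coin_walk a (w b) i \<omega> = x (Suc i)) \<and> coin_walk a (w b) (Suc n) \<omega> = y"
    have mP: "{\<omega>. ?P b \<omega>} \<in> sets (stream_space B)" for b
    proof -
      have "{\<omega> \<in> space (stream_space B). ?P b \<omega>} \<in> sets (stream_space B)" by measurable
      then show ?thesis by (simp add: sp)
    qed
    have mQ: "{\<omega>. ?Q b \<omega>} \<in> sets (stream_space B)" for b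
    proof -
      have "{\<omega> \<in> space (stream_space B). z = x 0 \<and>
          (\<forall>i\<le>n. coin_walk a (w b) i \<omega> = x (Suc i)) \<and> coin_walk a (w b) m \<omega> = y}
          \<in> sets (stream_space B)" for m
        by measurable
      from this[of "Suc n"] show ?thesis by (simp add: sp del: coin_walk.simps)
    qed
    have IH: "S.prob {\<omega>. ?Q b \<omega>} = S.prob {\<omega>. ?P b \<omega>} * ruin_kernel p a (x (Suc n)) y" for b
      using Suc.IH[of "w b" "\<lambda>i. x (Suc i)"] by (cases "z = x 0") (simp_all del: coin_walk.simps)
    have step: "coin_walk a z (Suc k) \<omega> = coin_walk a (w (shd \<omega>)) k (stl \<omega>)" for k \<omega>
      by (simp add: w_def)
    show ?case
      unfolding all_Suc step coin_walk.simps(1) conj_assoc first[of ?P, OF mP] first[of ?Q, OF mQ] IH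
      by (simp add: distrib_right)
  qed
  show ?thesis
    unfolding B_def[symmetric]
  proof unfold_locales
    show "coin_walk a z n \<in> measurable (stream_space B) (count_space {0..a})" for n
    proof (rule measurableI)
      show "coin_walk a z n \<omega> \<in> space (count_space {0..a})" for \<omega>
        using coin_walk_le[OF assms(3)] by simp
      show "coin_walk a z n -` A \<inter> space (stream_space B) \<in> sets (stream_space B)" for A
        by (rule measurable_sets[OF meas]) simp
    qed
    show "S.prob {\<omega> \<in> space (stream_space B). coin_walk a z 0 \<omega> = z} = 1"
      using S.prob_space by simp
  qed (use mk in \<open>simp add: sp del: coin_walk.simps\<close>)
qed

text \<open>One process on one measurable space serves all starting points at once.\<close>

lemma ruin_walk_family_exists:
  assumes "0 \<le> p" "p \<le> 1"
  shows "\<exists>(M :: nat \<Rightarrow> (nat \<times> bool stream) measure) X. \<forall>x\<in>{0..a}. ruin_walk (M x) X p a x"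
proof -
  define S where "S = stream_space (measure_pmf (bernoulli_pmf p))"
  define N where "N = count_space {0..a} \<Otimes>\<^sub>M S"
  define M where "M x = distr S N (\<lambda>\<omega>. (x, \<omega>))" for x
  define X where "X n = (\<lambda>(x, \<omega>). coin_walk a x n \<omega>)" for n
  have "ruin_walk (M x) X p a x" if x: "x \<in> {0..a}" for x
  proof -
    interpret W: ruin_walk S "coin_walk a x" p a x
      unfolding S_def using assms x by (intro ruin_walk_coin_walk) auto
    have pair: "(\<lambda>\<omega>. (x, \<omega>)) \<in> measurable S N"
      unfolding N_def using x by (intro measurable_Pair1') simp
    have XN: "X n \<in> measurable N (count_space {0..a})" for n
      unfolding N_def X_def
    proof (rule measurable_pair_measure_countable1)
      fix y assume "y \<in> {0..a}"
      then interpret Y: ruin_walk S "coin_walk a y" p a y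
        unfolding S_def using assms by (intro ruin_walk_coin_walk) auto
      show "(\<lambda>\<omega>. case (y, \<omega>) of (x, \<omega>) \<Rightarrow> coin_walk a x n \<omega>) \<in> measurable S (count_space {0..a})"
        using Y.measurable_walk by simp
    qed simp
    have [measurable]: "X n \<in> measurable N (count_space UNIV)" for n
      using measurable_comp[OF XN, of id "count_space UNIV"] by simp
    have spM: "space (M x) = space N" by (simp add: M_def)
    have transfer: "measure (M x) {v \<in> space (M x). P (\<lambda>n. X n v)} =
        W.prob {\<omega> \<in> space S. P (\<lambda>n. coin_walk a x n \<omega>)}"
      if "{v \<in> space N. P (\<lambda>n. X n v)} \<in> sets N" for P
      unfolding spM unfolding M_def measure_distr[OF pair that]
      using measurable_space[OF pair] by (auto intro!: arg_cong[of _ _ W.prob] simp: X_def)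
    interpret Mx: prob_space "M x"
      unfolding M_def by (rule W.prob_space_distr[OF pair])
    show ?thesis
    proof unfold_locales
      show "X n \<in> measurable (M x) (count_space {0..a})" for n
        using XN by (simp add: M_def)
      show "Mx.prob {v \<in> space (M x). X 0 v = x} = 1"
        using W.start by (subst transfer[of "\<lambda>f. f 0 = x"]) auto
      show "Mx.prob {v \<in> space (M x). (\<forall>i\<le>n. X i v = f i) \<and> X (Suc n) v = y} =
          Mx.prob {v \<in> space (M x). \<forall>i\<le>n. X i v = f i} * ruin_kernel p a (f n) y" for n f y
        using W.markov[of n f y]
        by (subst transfer[of "\<lambda>g. (\<forall>i\<le>n. g i = f i) \<and> g (Suc n) = y"],
            measurable, subst transfer[of "\<lambda>g. \<forall>i\<le>n. g i = f i"], measurable)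
    qed
  qed
  then show ?thesis by blast
qed

end

theory Submission
  imports Defs
begin

text \<open>
  Let \<open>s = 1 - \<gamma>\<close> and \<open>t = 1 / s\<close>. A function \<open>h\<close> with \<open>h 0 = 1\<close>, \<open>h a = 0\<close> and
  \<open>h x = s (p h (x + 1) + (1 - p) h (x - 1))\<close> for \<open>0 < x < a\<close> makes the stopped discounted
  process a bounded martingale, so \<open>u(z; \<gamma>) = h z\<close>. Solving the recurrence from the boundary \<open>a\<close>
  gives \<open>h x = U\<^sub>a\<^sub>-\<^sub>x(t) / U\<^sub>a(t)\<close>, where \<open>U\<^sub>0 = 0\<close>, \<open>U\<^sub>1 = 1\<close> and
  \<open>(1 - p) U\<^sub>k\<^sub>+\<^sub>2 = t U\<^sub>k\<^sub>+\<^sub>1 - p U\<^sub>k\<close>. The quotients \<open>r\<^sub>k = U\<^sub>k\<^sub>+\<^sub>1 / U\<^sub>k\<close> satisfy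
  \<open>(1 - p) r\<^sub>k\<^sub>+\<^sub>1 = t - p / r\<^sub>k\<close>, so each of them increases strictly with \<open>t\<close>, and
  \<open>u(z; \<gamma>) / u(z'; \<gamma>)\<close> is a product of such quotients or the inverse of one.
\<close>

section \<open>The recurrence from the upper boundary\<close>

text \<open>The index is the distance to the boundary \<open>a\<close>. For \<open>k > 0\<close>
  these are Chebyshev polynomials of the second kind of degree \<open>k - 1\<close> in
  \<open>t / (2 * sqrt (p * (1 - p)))\<close>, up to the factor
  \<open>(p / (1 - p)) powr ((k - 1) / 2)\<close>.\<close>

fun ruin_poly :: "real \<Rightarrow> real \<Rightarrow> nat \<Rightarrow> real" where
  "ruin_poly p t 0 = 0"
| "ruin_poly p t (Suc 0) = 1"
| "ruin_poly p t (Suc (Suc k)) = (t * ruin_poly p t (Suc k) - p * ruin_poly p t k) / (1 - p)"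

text \<open>Positivity alone does not survive the subtraction in the recurrence, so growth is
  carried along: \<open>t \<ge> 1\<close> and the previous increase bound the next numerator below
  by \<open>1 - p\<close> times the current value.\<close>

lemma ruin_poly_increasing:
  assumes "0 < p" "p < 1" "1 \<le> t"
  shows "0 \<le> ruin_poly p t k \<and> ruin_poly p t k < ruin_poly p t (Suc k)"
proof (induction k)
  case (Suc k)
  have "(1 - p) * ruin_poly p t (Suc k) < (1 - p) * ruin_poly p t (Suc (Suc k))"
  proof -
    have "1 * ruin_poly p t (Suc k) \<le> t * ruin_poly p t (Suc k)"
      using Suc assms by (intro mult_right_mono) auto
    moreover have "p * ruin_poly p t k < p * ruin_poly p t (Suc k)"
      using Suc assms by simp
    moreover have "(1 - p) * ruin_poly p t (Suc (Suc k)) = t * ruin_poly p t (Suc k) - p * ruin_poly p t k"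
      using assms by simp
    ultimately show ?thesis by (simp only: left_diff_distrib)
  qed
  then show ?case using Suc assms by (simp del: ruin_poly.simps)
qed simp

lemma ruin_poly_pos:
  assumes "0 < p" "p < 1" "1 \<le> t" "0 < k"
  shows "0 < ruin_poly p t k"
  using ruin_poly_increasing[OF assms(1-3), of "k - 1"] assms(4) by simp

lemma ruin_poly_Suc_ratio_less:
  assumes p: "0 < p" "p < 1" and t: "1 \<le> t" "t < t'" and "0 < k"
  shows "ruin_poly p t (Suc k) / ruin_poly p t k < ruin_poly p t' (Suc k) / ruin_poly p t' k"
  using \<open>0 < k\<close>
proof (induction k rule: nat_induct_non_zero)
  \<comment> \<open>As the value at index 0 vanishes, the first quotient is
    \<open>t / (1 - p)\<close>.\<close>
  case 1
  show ?case using p t by (simp add: divide_strict_right_mono)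
next
  case (Suc k)
  have pos: "0 < ruin_poly p t k" "0 < ruin_poly p t' k"
      "0 < ruin_poly p t (Suc k)" "0 < ruin_poly p t' (Suc k)"
    using p t Suc.hyps by (auto intro!: ruin_poly_pos)
  have expand: "ruin_poly p v (Suc (Suc k)) / ruin_poly p v (Suc k)
      = (v - p / (ruin_poly p v (Suc k) / ruin_poly p v k)) / (1 - p)"
    if "0 < ruin_poly p v (Suc k)" for v
    using that p by (simp add: field_simps)
  have "p / (ruin_poly p t' (Suc k) / ruin_poly p t' k) < p / (ruin_poly p t (Suc k) / ruin_poly p t k)"
    using Suc.IH p(1) pos by (intro divide_strict_left_mono mult_pos_pos divide_pos_pos)
  then show ?case
    unfolding expand[OF pos(3)] expand[OF pos(4)]
    using p t by (intro divide_strict_right_mono) auto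
qed

text \<open>The quotient telescopes into consecutive quotients, all positive and strictly increasing
  in \<open>t\<close>.\<close>

lemma ruin_poly_ratio_less:
  assumes p: "0 < p" "p < 1" and t: "1 \<le> t" "t < t'" and j: "0 < j" and "j < k"
  shows "ruin_poly p t k / ruin_poly p t j < ruin_poly p t' k / ruin_poly p t' j"
proof -
  note Suc_ratio = ruin_poly_Suc_ratio_less[OF p t]
  show ?thesis
    using Suc_leI[OF \<open>j < k\<close>]
  proof (induction rule: dec_induct)
    case base
    show ?case by (rule Suc_ratio[OF j])
  next
    case (step i)
    have pos: "0 < ruin_poly p t i" "0 < ruin_poly p t' i" "0 < ruin_poly p t j" "0 < ruin_poly p t' j"
      "0 < ruin_poly p t (Suc i)" "0 < ruin_poly p t' (Suc i)"
      using p t j step by (auto intro!: ruin_poly_pos)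
    have "(ruin_poly p t (Suc i) / ruin_poly p t i) * (ruin_poly p t i / ruin_poly p t j)
      < (ruin_poly p t' (Suc i) / ruin_poly p t' i) * (ruin_poly p t' i / ruin_poly p t' j)"
      using Suc_ratio[of i] step.IH step.hyps pos by (intro mult_strict_mono) auto
    then show ?case using pos by simp
  qed
qed

section \<open>Hitting times\<close>

text \<open>A finite infimum comes from a nonempty set, and by well-ordering it is attained.\<close>

lemma hitting_time_eq_enat_iff:
  "hitting_time X b \<omega> = enat k \<longleftrightarrow> X k \<omega> = b \<and> (\<forall>i<k. X i \<omega> \<noteq> b)"
proof
  assume hit: "hitting_time X b \<omega> = enat k"
  have "{n. X n \<omega> = b} \<noteq> {}"
    using hit unfolding hitting_time_def by (metis enat.distinct(1) image_empty Inf_empty top_enat_def)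
  then have "hitting_time X b \<omega> \<in> enat ` {n. X n \<omega> = b}"
    unfolding hitting_time_def by (metis (mono_tags, lifting) Inf_enat_def LeastI ex_in_conv image_is_empty)
  moreover have "\<not> i < k" if "X i \<omega> = b" for i
  proof -
    have "hitting_time X b \<omega> \<le> enat i"
      unfolding hitting_time_def using that by (intro INF_lower) simp
    then show ?thesis using hit by simp
  qed
  ultimately show "X k \<omega> = b \<and> (\<forall>i<k. X i \<omega> \<noteq> b)" using hit by auto
next
  assume hit: "X k \<omega> = b \<and> (\<forall>i<k. X i \<omega> \<noteq> b)"
  then have "k \<le> i" if "X i \<omega> = b" for i
    using that not_le_imp_less by blast
  with hit show "hitting_time X b \<omega> = enat k"
    unfolding hitting_time_def by (intro antisym INF_lower INF_greatest) auto
qed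

lemma enat_less_hitting_time_iff:
  "enat k < hitting_time X b \<omega> \<longleftrightarrow> (\<forall>i\<le>k. X i \<omega> \<noteq> b)"
proof
  assume less: "enat k < hitting_time X b \<omega>"
  show "\<forall>i\<le>k. X i \<omega> \<noteq> b"
  proof (intro allI impI notI)
    fix i assume "i \<le> k" "X i \<omega> = b"
    then have "hitting_time X b \<omega> \<le> enat i"
      unfolding hitting_time_def by (intro INF_lower) simp
    then show False using less \<open>i \<le> k\<close> by (metis enat_ord_simps(1) leD order_trans)
  qed
next
  assume "\<forall>i\<le>k. X i \<omega> \<noteq> b"
  \<comment> \<open>A lower bound of an infimum is only weak, so strictness is gained by passing to
    \<open>Suc k\<close>; this includes the value infinity.\<close>
  then have "enat (Suc k) \<le> hitting_time X b \<omega>"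
    unfolding hitting_time_def by (intro INF_greatest) (auto simp: not_less_eq_eq[symmetric])
  then show "enat k < hitting_time X b \<omega>"
    by (metis enat_ord_simps(2) lessI less_le_trans)
qed

section \<open>The discounted ruin probability\<close>

context ruin_walk
begin

text \<open>Only positions before time \<open>n\<close> must be interior, so \<open>x\<close> may be
  a boundary point: \<open>alive n 0\<close> is absorption at 0 at exactly time
  \<open>n\<close>.\<close>

definition alive :: "nat \<Rightarrow> nat \<Rightarrow> 'w set" where
  "alive n x = {\<omega> \<in> space M. (\<forall>i<n. X i \<omega> \<in> {1..a - 1}) \<and> X n \<omega> = x}"

lemma walk_le: "\<omega> \<in> space M \<Longrightarrow> X n \<omega> \<le> a"
  using measurable_space[OF measurable_walk, of \<omega> n] by simp

lemma measurable_walk_UNIV [measurable]: "X n \<in> measurable M (count_space UNIV)"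
  by (rule measurable_compose[OF measurable_walk, of "\<lambda>x. x", simplified]) simp

lemma sets_alive [measurable]: "alive n x \<in> events"
  unfolding alive_def atLeastAtMost_iff by measurable

text \<open>
  The past enters the Markov property only through single trajectories, so an event of the past
  is split into the finitely many trajectories it consists of.
\<close>

lemma markov_alive:
  "prob {\<omega> \<in> alive n x. X (Suc n) \<omega> = y} = prob (alive n x) * ruin_kernel p a x y"
proof -
  \<comment> \<open>Extensional functions keep the set of trajectories finite and make each
    trajectory a single element of it.\<close>
  define F where "F = {f \<in> {..n} \<rightarrow>\<^sub>E {0..a}. (\<forall>i<n. f i \<in> {1..a - 1}) \<and> f n = x}"
  define C where "C f = {\<omega> \<in> space M. \<forall>i\<le>n. X i \<omega> = f i}" for f :: "nat \<Rightarrow> nat"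
  define D where "D f = {\<omega> \<in> space M. (\<forall>i\<le>n. X i \<omega> = f i) \<and> X (Suc n) \<omega> = y}" for f :: "nat \<Rightarrow> nat"
  have fin: "finite F"
    unfolding F_def by (rule finite_subset[OF _ finite_PiE[of "{..n}" "\<lambda>_. {0..a}"]]) auto
  have meas: "C f \<in> events" "D f \<in> events" for f
    unfolding C_def D_def by measurable
  have disj: "f = g" if "f \<in> F" "g \<in> F" "\<omega> \<in> C f" "\<omega> \<in> C g" for f g \<omega>
  proof (rule PiE_ext[of _ "{..n}" "\<lambda>_. {0..a}"])
    show "f \<in> {..n} \<rightarrow>\<^sub>E {0..a}" "g \<in> {..n} \<rightarrow>\<^sub>E {0..a}" using that by (auto simp: F_def)
    show "f i = g i" if "i \<in> {..n}" for i
      using \<open>\<omega> \<in> C f\<close> \<open>\<omega> \<in> C g\<close> that unfolding C_def by auto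
  qed
  have DC: "D f \<subseteq> C f" for f unfolding C_def D_def by auto
  have trajectory: "\<exists>f\<in>F. \<forall>i\<le>n. X i \<omega> = f i" if "\<omega> \<in> alive n x" for \<omega>
    using that walk_le
    by (intro bexI[of _ "\<lambda>i\<in>{..n}. X i \<omega>"]) (auto simp: F_def alive_def)
  have UC: "alive n x = (\<Union>f\<in>F. C f)"
    using trajectory by (auto simp: C_def F_def alive_def)
  have UD: "{\<omega> \<in> alive n x. X (Suc n) \<omega> = y} = (\<Union>f\<in>F. D f)"
    using trajectory by (auto simp: D_def F_def alive_def)
  have "prob {\<omega> \<in> alive n x. X (Suc n) \<omega> = y} = (\<Sum>f\<in>F. prob (D f))"
    unfolding UD using fin meas disj DC
    by (intro finite_measure_finite_Union) (auto simp: disjoint_family_on_def, blast)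
  also have "\<dots> = (\<Sum>f\<in>F. prob (C f) * ruin_kernel p a x y)"
    unfolding C_def D_def markov by (intro sum.cong) (auto simp: F_def)
  also have "\<dots> = (\<Sum>f\<in>F. prob (C f)) * ruin_kernel p a x y"
    by (simp add: sum_distrib_right)
  also have "(\<Sum>f\<in>F. prob (C f)) = prob (alive n x)"
    unfolding UC using fin meas disj
    by (intro finite_measure_finite_Union[symmetric]) (auto simp: disjoint_family_on_def)
  finally show ?thesis .
qed

text \<open>Forward equation of the walk killed after reaching the boundary: the event at
  \<open>Suc n\<close> forces an interior position at time \<open>n\<close>.\<close>

lemma prob_alive_Suc:
  "prob (alive (Suc n) y) = (\<Sum>x\<in>{1..a - 1}. prob (alive n x) * ruin_kernel p a x y)"
proof -
  have "alive (Suc n) y = (\<Union>x\<in>{1..a - 1}. {\<omega> \<in> alive n x. X (Suc n) \<omega> = y})"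
    by (auto simp: alive_def less_Suc_eq)
  moreover have "{\<omega> \<in> alive n x. X (Suc n) \<omega> = y} \<in> events" for x
    by measurable
  moreover have "disjoint_family_on (\<lambda>x. {\<omega> \<in> alive n x. X (Suc n) \<omega> = y}) {1..a - 1}"
    by (auto simp: disjoint_family_on_def alive_def)
  ultimately have "prob (alive (Suc n) y) = (\<Sum>x\<in>{1..a - 1}. prob {\<omega> \<in> alive n x. X (Suc n) \<omega> = y})"
    by (simp add: finite_measure_finite_Union image_subset_iff)
  then show ?thesis by (simp add: markov_alive)
qed

lemma prob_alive_0: "prob (alive 0 x) = (if x = z then 1 else 0)"
proof -
  have "alive 0 z = {\<omega> \<in> space M. X 0 \<omega> = z}" by (simp add: alive_def)
  then have z: "prob (alive 0 z) = 1" by (simp only: start)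
  have "prob (alive 0 x) = 0" if "x \<noteq> z"
  proof -
    have "alive 0 x \<inter> alive 0 z = {}" using that unfolding alive_def by blast
    then have "prob (alive 0 x) + prob (alive 0 z) = prob (alive 0 x \<union> alive 0 z)"
      using sets_alive by (intro finite_measure_Union[symmetric])
    also have "\<dots> \<le> 1" by (rule prob_le_1)
    finally show ?thesis using z measure_nonneg[of M "alive 0 x"] by linarith
  qed
  then show ?thesis using z by simp
qed

section \<open>Discounted martingale and the generating function of the ruin time\<close>

lemma sum_ruin_kernel:
  fixes h :: "nat \<Rightarrow> real"
  assumes "x \<in> {1..a - 1}"
  shows "(\<Sum>y\<in>{0..a}. ruin_kernel p a x y * h y) = p * h (x + 1) + (1 - p) * h (x - 1)"
proof -
  obtain w where x: "x = Suc w" "Suc w < a" using assms by (cases x) auto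
  have kernel: "ruin_kernel p a x y = (if y = Suc (Suc w) then p else if y = w then 1 - p else 0)" for y
    using x unfolding ruin_kernel_def by simp
  have "(\<Sum>y\<in>{0..a}. ruin_kernel p a x y * h y) = (\<Sum>y\<in>{w, Suc (Suc w)}. ruin_kernel p a x y * h y)"
  proof (rule sum.mono_neutral_right)
    show "{w, Suc (Suc w)} \<subseteq> {0..a}" using x by simp
    show "\<forall>y\<in>{0..a} - {w, Suc (Suc w)}. ruin_kernel p a x y * h y = 0" by (simp add: kernel)
  qed simp
  then show ?thesis unfolding kernel using x(1) by simp
qed

text \<open>The expectation of the discounted process at time \<open>n\<close>, stopped at the boundary, is constant.\<close>

lemma stopped_expectation:
  fixes h :: "nat \<Rightarrow> real"
  assumes z: "z \<in> {1..a - 1}" and h0: "h 0 = 1" and ha: "h a = 0"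
    and harm: "\<And>x. x \<in> {1..a - 1} \<Longrightarrow> h x = s * (p * h (x + 1) + (1 - p) * h (x - 1))"
  shows "(\<Sum>m<n. s ^ m * prob (alive m 0)) + s ^ n * (\<Sum>x\<in>{0..a}. prob (alive n x) * h x) = h z"
proof (induction n)
  case 0
  show ?case using z by (auto simp: prob_alive_0 if_distrib[of "\<lambda>c. c * _"] cong: if_cong)
next
  case (Suc n)
  have "(\<Sum>y\<in>{0..a}. prob (alive (Suc n) y) * h y)
      = (\<Sum>y\<in>{0..a}. \<Sum>x\<in>{1..a - 1}. prob (alive n x) * (ruin_kernel p a x y * h y))"
    by (simp add: prob_alive_Suc sum_distrib_right mult.assoc)
  also have "\<dots> = (\<Sum>x\<in>{1..a - 1}. prob (alive n x) * (\<Sum>y\<in>{0..a}. ruin_kernel p a x y * h y))"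
    by (subst sum.swap) (simp add: sum_distrib_left)
  also have "s * \<dots> = (\<Sum>x\<in>{1..a - 1}. prob (alive n x) * h x)"
    unfolding sum_distrib_left[of s]
  proof (intro sum.cong refl)
    fix x assume x: "x \<in> {1..a - 1}"
    show "s * (prob (alive n x) * (\<Sum>y\<in>{0..a}. ruin_kernel p a x y * h y)) = prob (alive n x) * h x"
      by (simp only: sum_ruin_kernel[OF x] harm[OF x] mult.left_commute)
  qed
  finally have step: "s * (\<Sum>y\<in>{0..a}. prob (alive (Suc n) y) * h y)
      = (\<Sum>x\<in>{1..a - 1}. prob (alive n x) * h x)" .
  \<comment> \<open>The boundary values count mass at 0 once and mass at \<open>a\<close> not at
    all; the mass at 0 then moves into the sum of past ruin.\<close>
  have "{0..a} = insert 0 (insert a {1..a - 1})" "0 \<notin> insert a {1..a - 1}" "a \<notin> {1..a - 1}"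
    using z by auto
  then have split: "(\<Sum>x\<in>{0..a}. prob (alive n x) * h x)
      = prob (alive n 0) + (\<Sum>x\<in>{1..a - 1}. prob (alive n x) * h x)"
    by (simp only: sum.insert finite_insert finite_atLeastAtMost) (simp add: h0 ha)
  have "(\<Sum>m<Suc n. s ^ m * prob (alive m 0))
      + s ^ Suc n * (\<Sum>x\<in>{0..a}. prob (alive (Suc n) x) * h x)
    = (\<Sum>m<n. s ^ m * prob (alive m 0)) + s ^ n * (prob (alive n 0)
      + s * (\<Sum>x\<in>{0..a}. prob (alive (Suc n) x) * h x))"
    by (simp add: algebra_simps)
  also have "\<dots> = h z" unfolding step split[symmetric] by (rule Suc.IH)
  finally show ?case .
qed

text \<open>The remainder in the stopped identity is \<open>s ^ n\<close> times a quantity bounded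
  uniformly in \<open>n\<close>.\<close>

lemma ruin_sums:
  fixes h :: "nat \<Rightarrow> real"
  assumes "z \<in> {1..a - 1}" "h 0 = 1" "h a = 0"
    and "\<And>x. x \<in> {1..a - 1} \<Longrightarrow> h x = s * (p * h (x + 1) + (1 - p) * h (x - 1))"
    and s: "0 < s" "s < 1"
  shows "(\<lambda>m. s ^ m * prob (alive m 0)) sums h z"
proof -
  define C where "C = (\<Sum>x\<in>{0..a}. \<bar>h x\<bar>)"
  have bound: "\<bar>\<Sum>x\<in>{0..a}. prob (alive n x) * h x\<bar> \<le> C" for n
  proof -
    have "\<bar>\<Sum>x\<in>{0..a}. prob (alive n x) * h x\<bar> \<le> (\<Sum>x\<in>{0..a}. \<bar>prob (alive n x) * h x\<bar>)"
      by (rule sum_abs)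
    also have "\<dots> \<le> C"
      unfolding C_def by (intro sum_mono) (simp add: abs_mult mult_left_le_one_le)
    finally show ?thesis .
  qed
  have "(\<lambda>n. s ^ n * C) \<longlonglongrightarrow> 0"
    using s by (intro tendsto_mult_left_zero LIMSEQ_power_zero) simp
  then have "(\<lambda>n. s ^ n * (\<Sum>x\<in>{0..a}. prob (alive n x) * h x)) \<longlonglongrightarrow> 0"
    by (rule Lim_null_comparison[rotated])
      (use bound s in \<open>auto intro!: always_eventually simp: abs_mult mult_left_mono\<close>)
  then have "(\<lambda>n. h z - s ^ n * (\<Sum>x\<in>{0..a}. prob (alive n x) * h x)) \<longlonglongrightarrow> h z - 0"
    by (intro tendsto_diff tendsto_const)
  moreover have "h z - s ^ n * (\<Sum>x\<in>{0..a}. prob (alive n x) * h x)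
      = (\<Sum>m<n. s ^ m * prob (alive m 0))" for n
    using stopped_expectation[OF assms(1-4), of n] by simp
  ultimately show ?thesis by (simp add: sums_def)
qed

text \<open>The strict inequality of hitting times also excludes \<open>a\<close> at time
  \<open>k\<close> itself; this holds since the walk is then at \<open>0 \<noteq> a\<close>.\<close>

lemma ruin_iff_alive:
  assumes "0 < a" "\<omega> \<in> space M"
  shows "hitting_time X 0 \<omega> = enat k \<and> hitting_time X 0 \<omega> < hitting_time X a \<omega> \<longleftrightarrow> \<omega> \<in> alive k 0"
proof -
  have "X i \<omega> \<in> {1..a - 1} \<longleftrightarrow> X i \<omega> \<noteq> 0 \<and> X i \<omega> \<noteq> a" for i
    using walk_le[OF assms(2), of i] assms(1) by auto
  then have "\<omega> \<in> alive k 0 \<longleftrightarrow> hitting_time X 0 \<omega> = enat k \<and> enat k < hitting_time X a \<omega>"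
    unfolding alive_def hitting_time_eq_enat_iff enat_less_hitting_time_iff
    using assms by (auto simp: le_less)
  then show ?thesis by auto
qed

text \<open>The integrand is split by the time of ruin; dominated convergence with bound 1 exchanges
  series and integral.\<close>

lemma discounted_ruin_sums:
  assumes "0 < a" and \<gamma>: "0 < \<gamma>" "\<gamma> < 1"
  shows "(\<lambda>m. (1 - \<gamma>) ^ m * prob (alive m 0)) sums discounted_ruin M X a \<gamma>"
proof -
  define s where "s = 1 - \<gamma>"
  define g where "g \<omega> = s ^ the_enat (hitting_time X 0 \<omega>)
           * indicator {\<omega>. hitting_time X 0 \<omega> < hitting_time X a \<omega>} \<omega>" for \<omega>
  define S where "S n \<omega> = (\<Sum>m<n. s ^ m * indicator (alive m 0) \<omega>)" for n \<omega>
  have s: "0 < s" "s < 1" using \<gamma> by (auto simp: s_def)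
  have S: "S n \<omega> = (if \<exists>k<n. \<omega> \<in> alive k 0 then g \<omega> else 0)" if "\<omega> \<in> space M" for n \<omega>
  proof (cases "\<exists>k. \<omega> \<in> alive k 0")
    case True
    then obtain k where k: "\<omega> \<in> alive k 0" by blast
    note hit = ruin_iff_alive[OF assms(1) that]
    have uniq: "\<omega> \<in> alive m 0 \<longleftrightarrow> m = k" for m
      using k hit[of m] hit[of k] by auto
    have "S n \<omega> = (\<Sum>m<n. if m = k then s ^ k else 0)"
      unfolding S_def using uniq by (intro sum.cong) (auto simp: indicator_def)
    moreover have "g \<omega> = s ^ k"
      using k hit[of k] unfolding g_def by (metis indicator_simps(1) mem_Collect_eq mult_1_right the_enat.simps)
    ultimately show ?thesis using uniq by auto
  qed (auto simp: S_def)
  have g0: "g \<omega> = 0" if "\<omega> \<in> space M" "\<nexists>k. \<omega> \<in> alive k 0" for \<omega>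
    using that(2) ruin_iff_alive[OF assms(1) that(1)]
    by (cases "hitting_time X 0 \<omega>") (auto simp: g_def indicator_def)
  have g1: "\<bar>g \<omega>\<bar> \<le> 1" for \<omega>
    using s by (simp add: g_def indicator_def power_le_one)
  have lim: "(\<lambda>n. S n \<omega>) \<longlonglongrightarrow> g \<omega>" if \<omega>: "\<omega> \<in> space M" for \<omega>
  proof (cases "\<exists>k. \<omega> \<in> alive k 0")
    case True
    then obtain k where k: "\<omega> \<in> alive k 0" by blast
    have "\<forall>\<^sub>F n in sequentially. S n \<omega> = g \<omega>"
      using eventually_gt_at_top[of k] by eventually_elim (use k S[OF \<omega>] in auto)
    then show ?thesis by (rule tendsto_eventually)
  next
    case False
    then show ?thesis using S[OF \<omega>] g0[OF \<omega>] by simp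
  qed
  have S_meas: "S n \<in> borel_measurable M" for n
    unfolding S_def by measurable
  have "(\<lambda>n. \<integral>\<omega>. S n \<omega> \<partial>M) \<longlonglongrightarrow> (\<integral>\<omega>. g \<omega> \<partial>M)"
  proof (rule integral_dominated_convergence[where w = "\<lambda>_. 1"])
    show "g \<in> borel_measurable M"
      using S_meas lim by (rule borel_measurable_LIMSEQ_real[rotated])
    show "AE \<omega> in M. (\<lambda>n. S n \<omega>) \<longlonglongrightarrow> g \<omega>" using lim by (rule AE_I2)
    show "AE \<omega> in M. norm (S n \<omega>) \<le> 1" for n
      using S g1 by (intro AE_I2) auto
  qed (use S_meas in auto)
  moreover have "(\<integral>\<omega>. S n \<omega> \<partial>M) = (\<Sum>m<n. s ^ m * prob (alive m 0))" for n
    unfolding S_def by (subst Bochner_Integration.integral_sum) (auto simp: emeasure_eq_measure)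
  ultimately show ?thesis
    unfolding sums_def discounted_ruin_def g_def s_def by simp
qed

lemma discounted_ruin_eq_ruin_poly:
  assumes p: "0 < p" "p < 1" and z: "z \<in> {1..a - 1}" and \<gamma>: "0 < \<gamma>" "\<gamma> < 1"
  shows "discounted_ruin M X a \<gamma> = ruin_poly p (1 / (1 - \<gamma>)) (a - z) / ruin_poly p (1 / (1 - \<gamma>)) a"
proof -
  define t where "t = 1 / (1 - \<gamma>)"
  define h where "h x = ruin_poly p t (a - x) / ruin_poly p t a" for x
  have t: "1 \<le> t" "(1 - \<gamma>) * t = 1" using \<gamma> by (auto simp: t_def)
  have Ua: "0 < ruin_poly p t a" using p t z by (intro ruin_poly_pos) auto
  have "h x = (1 - \<gamma>) * (p * h (x + 1) + (1 - p) * h (x - 1))" if x: "x \<in> {1..a - 1}" for x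
  proof -
    \<comment> \<open>With this offset \<open>k\<close>, the neighbours of \<open>x\<close> get
      indices free of truncated subtraction; \<open>k = 0\<close> occurs at
      \<open>x = a - 1\<close>.\<close>
    define k where "k = a - (x + 1)"
    have idx: "a - (x + 1) = k" "a - x = Suc k" "a - (x - 1) = Suc (Suc k)"
      using x by (auto simp: k_def)
    have "(1 - p) * ruin_poly p t (Suc (Suc k)) = t * ruin_poly p t (Suc k) - p * ruin_poly p t k"
      using p by simp
    then have "p * ruin_poly p t k + (1 - p) * ruin_poly p t (Suc (Suc k)) = t * ruin_poly p t (Suc k)"
      by simp
    then have "p * h (x + 1) + (1 - p) * h (x - 1) = t * h x"
      unfolding h_def idx times_divide_eq_right add_divide_distrib[symmetric] by simp
    then show ?thesis using t(2) by (simp only: mult.assoc[symmetric] mult_1)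
  qed
  moreover have "h 0 = 1" "h a = 0" using Ua by (auto simp: h_def)
  ultimately have "(\<lambda>m. (1 - \<gamma>) ^ m * prob (alive m 0)) sums h z"
    using \<gamma> z by (intro ruin_sums) auto
  moreover have "(\<lambda>m. (1 - \<gamma>) ^ m * prob (alive m 0)) sums discounted_ruin M X a \<gamma>"
    using \<gamma> z by (intro discounted_ruin_sums) auto
  ultimately show ?thesis
    unfolding h_def t_def by (rule sums_unique2[symmetric])
qed

end

section \<open>Monotonicity of the ratio in the discount parameter\<close>

theorem propositionA3:
  fixes a z z' :: nat and p :: real
    and M :: "nat \<Rightarrow> 'w measure" and X :: "nat \<Rightarrow> 'w \<Rightarrow> nat"
  assumes "a \<ge> 3" and "0 < p" and "p < 1"
    and "\<And>x. x \<in> {1..a - 1} \<Longrightarrow> ruin_walk (M x) X p a x"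
    and "z \<in> {1..a - 1}" and "z' \<in> {1..a - 1}" and "z \<noteq> z'"
  shows "let R = (\<lambda>\<gamma>. discounted_ruin (M z) X a \<gamma> / discounted_ruin (M z') X a \<gamma>)
         in strict_mono_on {0<..<1} R \<or> strict_antimono_on {0<..<1} R"
proof -
  define R where "R \<gamma> = discounted_ruin (M z) X a \<gamma> / discounted_ruin (M z') X a \<gamma>" for \<gamma>
  define U where "U \<gamma> k = ruin_poly p (1 / (1 - \<gamma>)) k" for \<gamma> k
  have pos: "0 < U \<gamma> k" if "\<gamma> \<in> {0<..<1}" "0 < k" for \<gamma> k
    unfolding U_def using that assms(2,3) by (intro ruin_poly_pos) auto
  \<comment> \<open>The common denominator \<open>U \<gamma> a\<close> cancels.\<close>
  have R: "R \<gamma> = U \<gamma> (a - z) / U \<gamma> (a - z')" if "\<gamma> \<in> {0<..<1}" for \<gamma>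
    using that pos[OF that, of a] assms
      ruin_walk.discounted_ruin_eq_ruin_poly[OF assms(4)[OF assms(5)], of \<gamma>]
      ruin_walk.discounted_ruin_eq_ruin_poly[OF assms(4)[OF assms(6)], of \<gamma>]
    by (simp add: R_def U_def)
  have less: "U \<gamma> k / U \<gamma> j < U \<gamma>' k / U \<gamma>' j"
    if "\<gamma> \<in> {0<..<1}" "\<gamma>' \<in> {0<..<1}" "\<gamma> < \<gamma>'" "0 < j" "j < k" for \<gamma> \<gamma>' j k
    unfolding U_def using that assms(2,3)
    by (intro ruin_poly_ratio_less) (auto simp: frac_less2)
  have "strict_mono_on {0<..<1} R \<or> strict_antimono_on {0<..<1} R"
  proof (cases "z < z'")
    case True
    have "strict_mono_on {0<..<1} R"
      using less[of _ _ "a - z'" "a - z"] True assms(6)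
      by (intro strict_mono_onI) (auto simp: R)
    then show ?thesis ..
  next
    case False
    have "R \<gamma>' < R \<gamma>" if "\<gamma> \<in> {0<..<1}" "\<gamma>' \<in> {0<..<1}" "\<gamma> < \<gamma>'" for \<gamma> \<gamma>'
    proof -
      have idx: "0 < a - z" "0 < a - z'" "a - z < a - z'" using False assms(5-7) by auto
      \<comment> \<open>Here \<open>z' < z\<close>, so \<open>R\<close> is the reciprocal of an
        increasing quotient.\<close>
      have "inverse (U \<gamma>' (a - z') / U \<gamma>' (a - z)) < inverse (U \<gamma> (a - z') / U \<gamma> (a - z))"
        using less[OF that idx(1,3)] pos[OF that(1)] idx
        by (intro less_imp_inverse_less) auto
      then show ?thesis using R that by simp
    qed
    then have "strict_antimono_on {0<..<1} R" by (intro monotone_onI) auto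
    then show ?thesis ..
  qed
  then show ?thesis unfolding R_def Let_def .
qed

end
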